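(* Let $\sigma$ be the classical action of $L_+^\uparrow$ on $\mathcal K$ induced by $\rho$ and $\omega$, and $\sigma'$ the classical action of $L_+$ induced by $\rho'$ and $\omega'$. If a formal field theory $\mathcal D\subset\mathcal K$ is invariant under $\sigma(L_+^\uparrow)$, then it is invariant under $\sigma'(L_+^\downarrow)$.
   Context: $M$ is a real vector space of dimension $d\ge3$ with Lorentzian inner product $\eta$. $L_+^\uparrow$ is the identity component of the Lorentz group of $(M,\eta)$, $L_+^\downarrow$ the component of determinant-$+1$ time-orientation-reversing elements, $L_+=L_+^\uparrow\cup L_+^\downarrow$. The inclusion $L_+^\uparrow\subset L_+(\mathbb C)$ (complex determinant-one isometries of $M^{\mathbb C}$ with the complex-bilinear extension of $\eta$) identifies $L_+(\mathbb C)$ with the complexification $(L_+^\uparrow)^{\mathbb C}$, so $L_+\subset (L_+^\uparrow)^{\mathbb C}$. Given a finite-dimensional real representation $\rho$ of $L_+^\uparrow$ on $V$, its holomorphic extension $\rho^{\mathbb C}$ to $(L_+^\uparrow)^{\mathbb C}$ on $V^{\mathbb C}=\mathbb C\otimes V$ preserves $V$ when restricted to $L_+$; $\rho'$ denotes the resulting representation of $L_+$ on $V$. Similarly $\omega$ is a representation of $L_+^\uparrow$ on $M$ and $\omega'$ its extension to $L_+$ obtained the same way (if $\omega$ is the standard action, $\omega'$ is the standard action of $L_+$). $W=\mathrm{Hom}_{\mathbb R}(V,\mathbb C)$, $TM$ the real tensor algebra, $\mathcal K=\mathcal F(W\otimes_{\mathbb R}TM)$ the free non-commutative complex algebra, with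 field symbols $\underline\Phi^\lambda_{\xi_1\cdots\xi_n}=\lambda\otimes(\xi_1\otimes\cdots\otimes\xi_n)$. A formal field theory is a complex affine subspace of $\mathcal K$. The classical action of a group $G$ induced by representations $\rho$ on $V$ and $\omega$ on $M$ is the unique representation of $G$ on $\mathcal K$ by complex-linear algebra automorphisms with $\sigma(g)(\underline\Phi^\lambda_{\xi_1\cdots\xi_n})=\underline\Phi^{\lambda\circ\rho(g^{-1})}_{\omega(g)\xi_1\cdots\omega(g)\xi_n}$. Invariance means each transformation maps $\mathcal D$ into $\mathcal D$. *)

theory Defs
  imports "HOL-Analysis.Analysis" "HOL-Library.Poly_Mapping"
begin

definition eta :: "real^'n^'n \<Rightarrow> real^'n \<Rightarrow> real^'n \<Rightarrow> real" where
  "eta G x y = x \<bullet> (G *v y)"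

definition lorentzian :: "real^'n^'n \<Rightarrow> bool" where
  "lorentzian G \<longleftrightarrow> transpose G = G \<and>
     (\<exists>(P::real^'n^'n) t. invertible P \<and>
        (\<forall>i j. (transpose P ** G ** P) $ i $ j =
                 (if i \<noteq> j then 0 else if i = t then 1 else -1)))"

definition lorentz_group :: "real^'n^'n \<Rightarrow> (real^'n^'n) set" where
  "lorentz_group G = {A. transpose A ** G ** A = G}"

definition L_plus :: "real^'n^'n \<Rightarrow> (real^'n^'n) set" where
  "L_plus G = {A \<in> lorentz_group G. det A = 1}"

definition L_up :: "real^'n^'n \<Rightarrow> (real^'n^'n) set" where
  "L_up G = connected_component_set (lorentz_group G) (mat 1)"

text \<open>A Lorentz transformation reverses the time orientation iff it maps every
  timelike vector into the opposite (open) light cone.\<close>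
definition time_reversing :: "real^'n^'n \<Rightarrow> real^'n^'n \<Rightarrow> bool" where
  "time_reversing G A \<longleftrightarrow> (\<forall>v. eta G v v > 0 \<longrightarrow> eta G v (A *v v) < 0)"

definition L_down :: "real^'n^'n \<Rightarrow> (real^'n^'n) set" where
  "L_down G = {A \<in> L_plus G. time_reversing G A}"

definition cmat :: "real^'a^'b \<Rightarrow> complex^'a^'b" where
  "cmat A = (\<chi> i j. complex_of_real (A $ i $ j))"

definition cmat_scale :: "complex \<Rightarrow> complex^'a^'b \<Rightarrow> complex^'a^'b" where
  "cmat_scale c A = (\<chi> i j. c * A $ i $ j)"

definition L_plus_C :: "real^'n^'n \<Rightarrow> (complex^'n^'n) set" where
  "L_plus_C G = {A. transpose A ** cmat G ** A = cmat G \<and> det A = 1}"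

text \<open>Holomorphic map on a subset S of the complex matrices (S a complex submanifold):
  near every point of S it is the restriction of a map that is complex
  (Frechet-)differentiable on an open neighbourhood in the ambient space.\<close>
definition holo_on :: "(complex^'n^'n) set \<Rightarrow> (complex^'n^'n \<Rightarrow> complex^'m^'m) \<Rightarrow> bool" where
  "holo_on S F \<longleftrightarrow> (\<forall>x\<in>S. \<exists>U Fe. open U \<and> x \<in> U \<and> (\<forall>y\<in>U \<inter> S. Fe y = F y) \<and>
      (\<forall>y\<in>U. \<exists>f'. (Fe has_derivative f') (at y) \<and>
                   (\<forall>h. f' (cmat_scale \<i> h) = cmat_scale \<i> (f' h))))"

definition holo_extension ::
  "real^'n^'n \<Rightarrow> (real^'n^'n \<Rightarrow> real^'m^'m) \<Rightarrow> (complex^'n^'n \<Rightarrow> complex^'m^'m) \<Rightarrow> bool" where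
  "holo_extension G r rC \<longleftrightarrow>
     (\<forall>A\<in>L_up G. \<forall>B\<in>L_up G. r (A ** B) = r A ** r B) \<and> r (mat 1) = mat 1 \<and>
     continuous_on (L_up G) r \<and>
     (\<forall>A\<in>L_plus_C G. \<forall>B\<in>L_plus_C G. rC (A ** B) = rC A ** rC B) \<and> rC (mat 1) = mat 1 \<and>
     holo_on (L_plus_C G) rC \<and>
     (\<forall>A\<in>L_up G. rC (cmat A) = cmat (r A))"

text \<open>The induced representation r' of L_+ on the real space: rC restricted to L_+
  (which preserves the real subspace, so only real parts occur).\<close>
definition real_restr :: "(complex^'n^'n \<Rightarrow> complex^'m^'m) \<Rightarrow> real^'n^'n \<Rightarrow> real^'m^'m" where
  "real_restr rC A = (\<chi> i j. Re (rC (cmat A) $ i $ j))"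

text \<open>Basis of W \<otimes>_R TM over C: pairs (a, [i1,...,ik]) standing for
  e_a^* \<otimes> e_i1 \<otimes> ... \<otimes> e_ik (e_a basis of V = real^'v, e_i basis of M = real^'n).
  K is the free (tensor) algebra over C: finitely supported complex functions on words.\<close>
type_synonym ('v, 'n) kalg = "('v \<times> 'n list) list \<Rightarrow>\<^sub>0 complex"

definition kmul :: "('v, 'n) kalg \<Rightarrow> ('v, 'n) kalg \<Rightarrow> ('v, 'n) kalg" where
  "kmul p q = (\<Sum>w\<in>Poly_Mapping.keys p. \<Sum>u\<in>Poly_Mapping.keys q.
                 Poly_Mapping.single (w @ u) (Poly_Mapping.lookup p w * Poly_Mapping.lookup q u))"

definition kone :: "('v, 'n) kalg" where
  "kone = Poly_Mapping.single [] 1"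

definition ksc :: "complex \<Rightarrow> ('v, 'n) kalg \<Rightarrow> ('v, 'n) kalg" where
  "ksc c p = Poly_Mapping.map (\<lambda>z. c * z) p"

text \<open>Field symbol Phi^lambda_{xi_1...xi_k} = lambda \<otimes> (xi_1 \<otimes> ... \<otimes> xi_k),
  for lambda in W = Hom_R(V, C).\<close>
definition fsym :: "(real^'v::finite \<Rightarrow> complex) \<Rightarrow> (real^'n::finite) list \<Rightarrow> ('v, 'n) kalg" where
  "fsym l xs = (\<Sum>is\<in>{is. length is = length xs}. \<Sum>a\<in>UNIV.
      Poly_Mapping.single [(a, is)]
        (l (axis a 1) * complex_of_real (\<Prod>k<length xs. xs ! k $ (is ! k))))"

definition kauto :: "(('v, 'n) kalg \<Rightarrow> ('v, 'n) kalg) \<Rightarrow> bool" where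
  "kauto f \<longleftrightarrow> (\<forall>p q. f (p + q) = f p + f q) \<and> (\<forall>c p. f (ksc c p) = ksc c (f p)) \<and>
     (\<forall>p q. f (kmul p q) = kmul (f p) (f q)) \<and> f kone = kone \<and> bij f"

definition classical_action ::
  "(real^'n^'n) set \<Rightarrow> (real^'n^'n \<Rightarrow> real^'v^'v) \<Rightarrow> (real^'n^'n \<Rightarrow> real^'n^'n)
   \<Rightarrow> (real^'n^'n \<Rightarrow> ('v::finite, 'n::finite) kalg \<Rightarrow> ('v, 'n) kalg) \<Rightarrow> bool" where
  "classical_action Grp r w \<sigma> \<longleftrightarrow>
     (\<forall>g\<in>Grp. kauto (\<sigma> g)) \<and>
     (\<forall>g\<in>Grp. \<forall>h\<in>Grp. \<sigma> (g ** h) = \<sigma> g \<circ> \<sigma> h) \<and>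
     \<sigma> (mat 1) = id \<and>
     (\<forall>g\<in>Grp. \<forall>l xs. linear l \<longrightarrow>
        \<sigma> g (fsym l xs) = fsym (\<lambda>v. l (r (matrix_inv g) *v v)) (map (\<lambda>x. w g *v x) xs))"

definition caffine :: "('v, 'n) kalg set \<Rightarrow> bool" where
  "caffine D \<longleftrightarrow> (\<forall>x\<in>D. \<forall>y\<in>D. \<forall>t::complex. ksc t x + ksc (1 - t) y \<in> D)"

definition invariant_under :: "('a \<Rightarrow> 'k \<Rightarrow> 'k) \<Rightarrow> 'a set \<Rightarrow> 'k set \<Rightarrow> bool" where
  "invariant_under \<sigma> S D \<longleftrightarrow> (\<forall>g\<in>S. \<sigma> g ` D \<subseteq> D)"

end

theory Submission
  imports Defs "HOL-Complex_Analysis.Conformal_Mappings"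
begin

text \<open>
  Every element of \<open>L_plus G\<close> is a product of pairs of reflections \<open>s\<^sub>v s\<^sub>u\<close> in anisotropic vectors.
  Each such pair lies on the holomorphic curve \<open>z \<mapsto> s\<^sub>w s\<^sub>u\<close>, where \<open>w = u + z (v - u)\<close>, in the complex
  Lorentz group. It is defined for all but finitely many complex \<open>z\<close>, starts at the identity for
  \<open>z = 0\<close>, reaches \<open>s\<^sub>v s\<^sub>u\<close> at \<open>z = 1\<close>, and lies in \<open>L_up G\<close> for small real \<open>z\<close>. Applying the complexified
  action along this curve to an element of \<open>D\<close> gives a holomorphic combination of finitely many vectors
  that lies in the complex affine space \<open>D\<close> for small real \<open>z\<close>, hence for all \<open>z\<close>, in particular for
  \<open>z = 1\<close>. Multiplicativity of \<open>\<sigma>'\<close> then gives invariance under all of \<open>L_plus G\<close>.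
\<close>

subsection \<open>The free algebra and its induced automorphisms\<close>

lemma lookup_ksc [simp]: "Poly_Mapping.lookup (ksc c p) k = c * Poly_Mapping.lookup p k"
  by (simp add: ksc_def Poly_Mapping.map.rep_eq when_def)

lemma ksc_add_right: "ksc c (p + q) = ksc c p + ksc c q"
  and ksc_add_left: "ksc (c + d) p = ksc c p + ksc d p"
  and ksc_ksc: "ksc c (ksc d p) = ksc (c * d) p"
  and ksc_one [simp]: "ksc 1 p = p"
  and ksc_zero_left [simp]: "ksc 0 p = 0"
  and ksc_zero_right [simp]: "ksc c 0 = 0"
  by (rule poly_mapping_eqI; simp add: lookup_add algebra_simps)+

lemma ksc_single: "ksc c (Poly_Mapping.single w d) = Poly_Mapping.single w (c * d)"
  by (rule poly_mapping_eqI) (simp add: lookup_single when_def)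

lemma ksc_sum: "ksc c (sum f A) = (\<Sum>x\<in>A. ksc c (f x))"
  by (rule poly_mapping_eqI) (simp add: lookup_sum sum_distrib_left)

text \<open>Supplies the notion of complex linear subspace, \<open>kvs.subspace\<close>, in which
  the directions of an affine field theory are studied.\<close>

interpretation kvs: vector_space ksc
  by unfold_locales (simp_all add: ksc_add_right ksc_add_left ksc_ksc)

lemma kalg_expand: "p = (\<Sum>w\<in>Poly_Mapping.keys p. ksc (Poly_Mapping.lookup p w) (Poly_Mapping.single w 1))"
proof (rule poly_mapping_eqI)
  fix k
  have "Poly_Mapping.lookup (\<Sum>w\<in>Poly_Mapping.keys p. ksc (Poly_Mapping.lookup p w) (Poly_Mapping.single w 1)) k
      = (\<Sum>w\<in>Poly_Mapping.keys p. if w = k then Poly_Mapping.lookup p w else 0)"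
    unfolding lookup_sum by (intro sum.cong refl) (simp add: lookup_single)
  also have "\<dots> = Poly_Mapping.lookup p k"
    by (simp add: in_keys_iff)
  finally show "Poly_Mapping.lookup p k = Poly_Mapping.lookup (\<Sum>w\<in>Poly_Mapping.keys p.
      ksc (Poly_Mapping.lookup p w) (Poly_Mapping.single w 1)) k" by simp
qed

text \<open>Words outside the supports contribute zero terms. Enlarged index sets let
  \<open>p\<close>, \<open>p'\<close> and \<open>p + p'\<close> be expanded over one common set,
  even when cancellation shrinks the support of the sum.\<close>

lemma kmul_superset:
  assumes "finite A" "finite B" "Poly_Mapping.keys p \<subseteq> A" "Poly_Mapping.keys q \<subseteq> B"
  shows "kmul p q = (\<Sum>w\<in>A. \<Sum>u\<in>B.
      Poly_Mapping.single (w @ u) (Poly_Mapping.lookup p w * Poly_Mapping.lookup q u))"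
proof -
  have inner: "(\<Sum>u\<in>Poly_Mapping.keys q. Poly_Mapping.single (w @ u) (Poly_Mapping.lookup p w * Poly_Mapping.lookup q u))
     = (\<Sum>u\<in>B. Poly_Mapping.single (w @ u) (Poly_Mapping.lookup p w * Poly_Mapping.lookup q u))" for w
    using assms by (intro sum.mono_neutral_left) (auto simp: in_keys_iff)
  show ?thesis
    unfolding kmul_def inner
    using assms by (intro sum.mono_neutral_left) (auto simp: in_keys_iff)
qed

lemma kmul_add_left: "kmul (p + p') q = kmul p q + kmul p' q"
proof -
  define A where "A = Poly_Mapping.keys p \<union> Poly_Mapping.keys p'"
  have *: "finite A" "Poly_Mapping.keys (p + p') \<subseteq> A" "Poly_Mapping.keys p \<subseteq> A" "Poly_Mapping.keys p' \<subseteq> A"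
    using Poly_Mapping.keys_add[of p p'] by (auto simp: A_def)
  show ?thesis
    using * by (simp add: kmul_superset[of A "Poly_Mapping.keys q"] lookup_add
        distrib_right single_add sum.distrib)
qed

lemma kmul_add_right: "kmul p (q + q') = kmul p q + kmul p q'"
proof -
  define A where "A = Poly_Mapping.keys q \<union> Poly_Mapping.keys q'"
  have *: "finite A" "Poly_Mapping.keys (q + q') \<subseteq> A" "Poly_Mapping.keys q \<subseteq> A" "Poly_Mapping.keys q' \<subseteq> A"
    using Poly_Mapping.keys_add[of q q'] by (auto simp: A_def)
  show ?thesis
    using * by (simp add: kmul_superset[of "Poly_Mapping.keys p" A] lookup_add
        distrib_left single_add sum.distrib)
qed

lemma keys_ksc_subset: "Poly_Mapping.keys (ksc c p) \<subseteq> Poly_Mapping.keys p"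
  by (auto simp: in_keys_iff)

lemma kmul_ksc: "kmul (ksc c p) (ksc d q) = ksc (c * d) (kmul p q)"
  by (simp add: kmul_superset[OF _ _ keys_ksc_subset keys_ksc_subset]
      kmul_superset[of "Poly_Mapping.keys p" "Poly_Mapping.keys q" p q]
      ksc_sum ksc_single algebra_simps)

lemma kmul_single:
  "kmul (Poly_Mapping.single w c) (Poly_Mapping.single u d) = Poly_Mapping.single (w @ u) (c * d)"
  by (subst kmul_superset[of "{w}" "{u}"]) auto

text \<open>Row \<open>a\<close> of \<open>P\<close> holds the coordinates of the
  \<open>a\<close>-th coordinate functional composed with \<open>P\<close>, and column
  \<open>i\<close> of \<open>Q\<close> those of the image of the \<open>i\<close>-th basis vector.
  Complex entries are allowed so that the formula also makes sense off the real group.\<close>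

definition letter_image :: "complex^'v^'v \<Rightarrow> complex^'n^'n \<Rightarrow> 'v \<times> 'n list \<Rightarrow> ('v::finite, 'n::finite) kalg" where
  "letter_image P Q x = (\<Sum>js\<in>{js. length js = length (snd x)}. \<Sum>b\<in>UNIV.
     ksc (P $ fst x $ b * (\<Prod>k<length (snd x). Q $ (js ! k) $ (snd x ! k)))
       (Poly_Mapping.single [(b, js)] 1))"

definition word_image :: "complex^'v^'v \<Rightarrow> complex^'n^'n \<Rightarrow> ('v \<times> 'n list) list \<Rightarrow> ('v::finite, 'n::finite) kalg" where
  "word_image P Q w = foldr (\<lambda>x. kmul (letter_image P Q x)) w kone"

text \<open>For real \<open>g\<close>, \<open>P\<close> is \<open>\<rho>(g\<inverse>)\<close> and \<open>Q\<close> is \<open>\<omega>(g)\<close>.\<close>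
definition induced_action :: "complex^'v^'v \<Rightarrow> complex^'n^'n \<Rightarrow> ('v::finite, 'n::finite) kalg \<Rightarrow> ('v, 'n) kalg" where
  "induced_action P Q p = (\<Sum>w\<in>Poly_Mapping.keys p. ksc (Poly_Mapping.lookup p w) (word_image P Q w))"

lemma letter_image_cmat:
  fixes R :: "real^'v::finite^'v" and B :: "real^'n::finite^'n"
  shows "letter_image (cmat R) (cmat B) (a, is) =
     fsym (\<lambda>v. complex_of_real ((R *v v) $ a)) (map (\<lambda>x. B *v x) (map (\<lambda>i. axis i 1) is))"
  by (auto simp: letter_image_def fsym_def ksc_single cmat_def matrix_vector_mult_basis column_def
      intro!: sum.cong arg_cong2[of _ _ _ _ Poly_Mapping.single] arg_cong2[of _ _ _ _ "(*)"] prod.cong)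

lemma cmat_mat_1 [simp]: "cmat (mat 1) = mat 1"
  by (simp add: cmat_def mat_def vec_eq_iff)

lemma prod_delta_nth:
  assumes "length js = length is"
  shows "(\<Prod>k<length is. if js ! k = is ! k then 1 else (0::'a::comm_semiring_1)) = (if js = is then 1 else 0)"
proof (cases "js = is")
  case False
  then obtain k where "k < length is" "js ! k \<noteq> is ! k"
    using assms nth_equalityI by metis
  then show ?thesis using False by (auto intro!: prod_zero)
qed simp

lemma letter_image_mat_1:
  fixes a :: "'v::finite" and "is" :: "'n::finite list"
  shows "letter_image (mat 1) (mat 1) (a, is) = Poly_Mapping.single [(a, is)] 1"
proof -
  have fin: "finite {js :: 'n list. length js = length is}"
    using finite_lists_length_eq[of "UNIV :: 'n set" "length is"] by simp
  have "letter_image (mat 1) (mat 1) (a, is) = (\<Sum>js\<in>{js. length js = length is}. \<Sum>b\<in>UNIV.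
     ksc (if b = a then if js = is then 1 else 0 else 0) (Poly_Mapping.single [(b, js)] 1))"
    unfolding letter_image_def
    by (intro sum.cong refl arg_cong2[of _ _ _ _ ksc])
      (auto simp: mat_def prod_delta_nth)
  also have "\<dots> = (\<Sum>js\<in>{js. length js = length is}. if js = is then Poly_Mapping.single [(a, js)] 1 else 0)"
    by (intro sum.cong refl) (auto simp: if_distrib[of "\<lambda>c. ksc c _"] sum.delta cong: if_cong)
  also have "\<dots> = Poly_Mapping.single [(a, is)] 1"
    using fin by (simp add: sum.delta)
  finally show ?thesis .
qed

text \<open>The basis letters are field symbols and generate the algebra, so the values on field
  symbols leave no freedom. This brings \<open>\<sigma>\<close> and \<open>\<sigma>'\<close> under
  one formula in the matrix entries.\<close>

lemma kauto_eq_induced_action: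
  fixes R :: "real^'v::finite^'v" and B :: "real^'n::finite^'n"
  assumes f: "kauto f"
    and fsym: "\<And>l xs. linear l \<Longrightarrow> f (fsym l xs) = fsym (\<lambda>v. l (R *v v)) (map (\<lambda>x. B *v x) xs)"
  shows "f p = induced_action (cmat R) (cmat B) p"
proof -
  have add: "f (p + q) = f p + f q" and sc: "f (ksc c p) = ksc c (f p)"
    and mul: "f (kmul p q) = kmul (f p) (f q)" and one: "f kone = kone" for p q c
    using f by (auto simp: kauto_def)
  have zero: "f 0 = 0" using sc[of 0 0] by simp
  have sum: "f (sum g A) = (\<Sum>x\<in>A. f (g x))" if "finite A" for g :: "('v \<times> 'n list) list \<Rightarrow> _" and A
    using that by induction (simp_all add: add zero)
  have letter: "f (Poly_Mapping.single [x] 1) = letter_image (cmat R) (cmat B) x" for x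
  proof (cases x)
    case (Pair a "is")
    have lin: "linear (\<lambda>v::real^'v. complex_of_real (v $ a))"
      by (rule linearI) (simp_all add: scaleR_conv_of_real[where 'a = complex])
    \<comment> \<open>With both matrices equal to the identity, \<open>letter_image_cmat\<close>
      exhibits the letter itself as the field symbol of a coordinate functional and basis
      vectors.\<close>
    have "Poly_Mapping.single [x] 1 = fsym (\<lambda>v. complex_of_real (v $ a)) (map (\<lambda>i. axis i 1) is)"
      using letter_image_cmat[of "mat 1" "mat 1" a "is"]
      by (simp add: letter_image_mat_1 Pair comp_def)
    then show ?thesis
      using fsym[OF lin, of "map (\<lambda>i. axis i 1) is"] by (simp add: letter_image_cmat Pair)
  qed
  have word: "f (Poly_Mapping.single w 1) = word_image (cmat R) (cmat B) w" for w
  proof (induction w)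
    case Nil
    then show ?case using one by (simp add: word_image_def kone_def)
  next
    case (Cons x w)
    have "Poly_Mapping.single (x # w) 1 = kmul (Poly_Mapping.single [x] (1::complex)) (Poly_Mapping.single w 1)"
      by (simp add: kmul_single)
    then show ?case
      by (simp add: mul letter Cons.IH) (simp add: word_image_def)
  qed
  have "f p = f (\<Sum>w\<in>Poly_Mapping.keys p. ksc (Poly_Mapping.lookup p w) (Poly_Mapping.single w 1))"
    using kalg_expand[of p] by simp
  also have "\<dots> = induced_action (cmat R) (cmat B) p"
    by (simp add: sum sc word induced_action_def)
  finally show ?thesis .
qed

subsection \<open>Holomorphic curves in the free algebra\<close>

text \<open>Holomorphy without a topology on the infinite-dimensional algebra: the values stay in
  the span of finitely many fixed vectors. The inductive form turns closure under sums and products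
  into short inductions.\<close>

inductive khol :: "complex set \<Rightarrow> (complex \<Rightarrow> ('v, 'n) kalg) \<Rightarrow> bool" for \<Omega> where
  zero: "khol \<Omega> (\<lambda>z. 0)"
| add_ksc: "f holomorphic_on \<Omega> \<Longrightarrow> khol \<Omega> F \<Longrightarrow> khol \<Omega> (\<lambda>z. ksc (f z) b + F z)"

lemma khol_ksc_const: "f holomorphic_on \<Omega> \<Longrightarrow> khol \<Omega> (\<lambda>z. ksc (f z) b)"
  using khol.add_ksc[OF _ khol.zero, of f \<Omega> b] by simp

lemma khol_const: "khol \<Omega> (\<lambda>z. b)"
  using khol_ksc_const[of "\<lambda>z. 1" \<Omega> b] by simp

lemma khol_add:
  assumes "khol \<Omega> F" "khol \<Omega> H"
  shows "khol \<Omega> (\<lambda>z. F z + H z)"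
  using assms(1)
proof induction
  case zero
  then show ?case using assms(2) by simp
next
  case (add_ksc f F b)
  then show ?case using khol.add_ksc[OF add_ksc(1) add_ksc(3), of b] by (simp add: add.assoc)
qed

lemma khol_ksc:
  assumes "g holomorphic_on \<Omega>" "khol \<Omega> F"
  shows "khol \<Omega> (\<lambda>z. ksc (g z) (F z))"
  using assms(2)
proof induction
  case zero
  then show ?case by (simp add: khol.zero)
next
  case (add_ksc f F b)
  have "(\<lambda>z. g z * f z) holomorphic_on \<Omega>" using assms(1) add_ksc(1) by (intro holomorphic_intros)
  from khol.add_ksc[OF this add_ksc(3), of b] show ?case by (simp add: ksc_add_right ksc_ksc)
qed

lemma khol_sum: "(\<And>x. x \<in> A \<Longrightarrow> khol \<Omega> (F x)) \<Longrightarrow> khol \<Omega> (\<lambda>z. \<Sum>x\<in>A. F x z)"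
  by (induction A rule: infinite_finite_induct) (auto intro: khol_add khol.zero)

lemma kmul_zero [simp]: "kmul 0 p = 0" "kmul p 0 = 0"
  by (simp_all add: kmul_def)

lemma khol_kmul:
  assumes "khol \<Omega> F" "khol \<Omega> H"
  shows "khol \<Omega> (\<lambda>z. kmul (F z) (H z))"
  using assms(1)
proof induction
  case zero
  then show ?case by (simp add: khol.zero)
next
  case (add_ksc f F b)
  have "khol \<Omega> (\<lambda>z. kmul (ksc (f z) b) (H z))"
    using assms(2)
  proof induction
    case zero
    then show ?case by (simp add: khol.zero)
  next
    case (add_ksc h H c)
    have "(\<lambda>z. f z * h z) holomorphic_on \<Omega>"
      using \<open>f holomorphic_on \<Omega>\<close> add_ksc(1) by (intro holomorphic_intros)
    from khol.add_ksc[OF this add_ksc(3), of "kmul b c"] show ?case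
      by (simp add: kmul_add_right kmul_ksc)
  qed
  from khol_add[OF this add_ksc(3)] show ?case by (simp add: kmul_add_left)
qed

text \<open>For fixed \<open>p\<close> only finitely many words occur, and their coefficients are
  polynomials in the matrix entries.\<close>

lemma khol_induced_action:
  fixes P :: "complex \<Rightarrow> complex^'v::finite^'v" and Q :: "complex \<Rightarrow> complex^'n::finite^'n"
  assumes "\<And>i j. (\<lambda>z. P z $ i $ j) holomorphic_on \<Omega>" "\<And>i j. (\<lambda>z. Q z $ i $ j) holomorphic_on \<Omega>"
  shows "khol \<Omega> (\<lambda>z. induced_action (P z) (Q z) p)"
proof -
  have letter: "khol \<Omega> (\<lambda>z. letter_image (P z) (Q z) x)" for x
    unfolding letter_image_def using assms
    by (intro khol_sum khol_ksc_const holomorphic_intros)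
  have "khol \<Omega> (\<lambda>z. word_image (P z) (Q z) w)" for w
    by (induction w) (simp_all add: word_image_def khol_const khol_kmul letter)
  then show ?thesis
    unfolding induced_action_def by (intro khol_sum khol_ksc) auto
qed

text \<open>The indexed form prepares an induction on the number of vectors. Functions with index
  beyond \<open>n\<close> are holomorphic too, as \<open>holomorphic_sum_in_subspace\<close>
  expects.\<close>

lemma khol_imp_sum:
  assumes "khol \<Omega> F"
  shows "\<exists>n f b. (\<forall>i. f i holomorphic_on \<Omega>) \<and> F = (\<lambda>z. \<Sum>i<(n::nat). ksc (f i z) (b i))"
  using assms
proof induction
  case zero
  show ?case by (intro exI[of _ 0] exI[of _ "\<lambda>i z. 0"]) auto
next
  case (add_ksc g F c)
  then obtain n f b where *: "\<And>i. f i holomorphic_on \<Omega>" "F = (\<lambda>z. \<Sum>i<(n::nat). ksc (f i z) (b i))"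
    by blast
  have "F z = (\<Sum>i<n. ksc ((f(n := g)) i z) ((b(n := c)) i))" for z
    unfolding *(2) by (intro sum.cong) auto
  then show ?case using *(1) add_ksc(1)
    by (intro exI[of _ "Suc n"] exI[of _ "f(n := g)"] exI[of _ "b(n := c)"]) (auto simp: add.commute)
qed

section \<open>Identity theorem modulo a complex affine subspace\<close>

text \<open>The induction eliminates one vector at a time: if its coefficient is nonzero at a
  point of \<open>U\<close>, that vector is congruent modulo \<open>S\<close> to a combination of the others.\<close>

lemma holomorphic_sum_in_subspace:
  assumes S: "kvs.subspace S"
    and \<Omega>: "open \<Omega>" "connected \<Omega>" "U \<subseteq> \<Omega>" "\<xi> \<in> \<Omega>" "\<xi> islimpt U" "w \<in> \<Omega>"
    and "\<And>i. f i holomorphic_on \<Omega>"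
    and "\<And>z. z \<in> U \<Longrightarrow> (\<Sum>i<n. ksc (f i z) (b i)) \<in> S"
  shows "(\<Sum>i<(n::nat). ksc (f i w) (b i)) \<in> S"
  using assms(8,9)
proof (induction n arbitrary: f)
  case 0
  then show ?case using S by (simp add: kvs.subspace_0)
next
  case (Suc n)
  show ?case
  proof (cases "\<forall>z\<in>U. f n z = 0")
    case True
    have "f n w = 0"
      by (rule analytic_continuation[OF Suc.prems(1)[of n] \<Omega>(1-5) _ \<Omega>(6)]) (use True in simp)
    moreover have "(\<Sum>i<n. ksc (f i w) (b i)) \<in> S"
    proof (rule Suc.IH)
      show "(\<Sum>i<n. ksc (f i z) (b i)) \<in> S" if "z \<in> U" for z
        using Suc.prems(2)[OF that] True that by simp
    qed (rule Suc.prems(1))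
    ultimately show ?thesis by simp
  next
    case False
    then obtain z0 where z0: "z0 \<in> U" "f n z0 \<noteq> 0" by blast
    \<comment> \<open>\<open>h\<close> is normalised so that subtracting \<open>h z\<close> times
      the combination at \<open>z0\<close>, an element of \<open>S\<close>, cancels the coefficient
      of \<open>b n\<close> and leaves \<open>n\<close> terms.\<close>
    define h where "h z = f n z / f n z0" for z
    have h: "h holomorphic_on \<Omega>"
      unfolding h_def using Suc.prems(1)[of n] z0(2) by (intro holomorphic_intros) auto
    have eq: "(\<Sum>i<n. ksc (f i z - h z * f i z0) (b i)) =
        (\<Sum>i<Suc n. ksc (f i z) (b i)) - ksc (h z) (\<Sum>i<Suc n. ksc (f i z0) (b i))" for z
    proof -
      have "ksc (h z) (ksc (f n z0) (b n)) = ksc (f n z) (b n)"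
        using z0(2) by (simp add: h_def ksc_ksc)
      then show ?thesis
        by (simp only: lessThan_Suc sum.insert finite_lessThan lessThan_iff less_irrefl not_False_eq_True
            kvs.scale_left_diff_distrib sum_subtractf ksc_add_right ksc_sum ksc_ksc) simp
    qed
    have "(\<Sum>i<n. ksc (f i w - h w * f i z0) (b i)) \<in> S"
    proof (rule Suc.IH)
      show "(\<lambda>z. f i z - h z * f i z0) holomorphic_on \<Omega>" for i
        using Suc.prems(1) h by (intro holomorphic_intros) auto
      show "(\<Sum>i<n. ksc (f i z - h z * f i z0) (b i)) \<in> S" if "z \<in> U" for z
        unfolding eq using Suc.prems(2)[OF that] Suc.prems(2)[OF z0(1)] S
        by (intro kvs.subspace_diff kvs.subspace_scale)
    qed
    then have "(\<Sum>i<n. ksc (f i w - h w * f i z0) (b i)) + ksc (h w) (\<Sum>i<Suc n. ksc (f i z0) (b i)) \<in> S"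
      using Suc.prems(2)[OF z0(1)] S by (intro kvs.subspace_add kvs.subspace_scale)
    then show ?thesis unfolding eq by simp
  qed
qed

text \<open>A scaling is an affine combination with the base point, and a sum is twice a midpoint;
  so moving \<open>x0\<close> to the origin makes \<open>D\<close> linear.\<close>

lemma caffine_subspace:
  assumes D: "caffine D" and x0: "x0 \<in> D"
  shows "kvs.subspace {x. x + x0 \<in> D}"
proof (rule kvs.subspaceI)
  have scale: "ksc c x + x0 \<in> D" if "x + x0 \<in> D" for c x
  proof -
    have "ksc c (x + x0) + ksc (1 - c) x0 \<in> D"
      using D that x0 by (auto simp: caffine_def)
    then show ?thesis
      by (simp add: ksc_add_right add.assoc flip: ksc_add_left)
  qed
  show "0 \<in> {x. x + x0 \<in> D}" using x0 by simp
  show "ksc c x \<in> {x. x + x0 \<in> D}" if "x \<in> {x. x + x0 \<in> D}" for c x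
    using scale that by simp
  show "x + y \<in> {x. x + x0 \<in> D}" if "x \<in> {x. x + x0 \<in> D}" "y \<in> {x. x + x0 \<in> D}" for x y
  proof -
    have "ksc (1/2) (x + x0) + ksc (1 - 1/2) (y + x0) \<in> D"
      using D that unfolding caffine_def by blast
    also have "ksc (1/2) (x + x0) + ksc (1 - 1/2) (y + x0) = ksc (1/2) (x + y) + x0"
      by (rule poly_mapping_eqI) (simp add: lookup_add algebra_simps)
    finally have "ksc 2 (ksc (1/2) (x + y)) + x0 \<in> D" by (rule scale)
    then show ?thesis by (simp add: ksc_ksc)
  qed
qed

text \<open>After subtraction of a value that \<open>F\<close> attains on \<open>U\<close>,
  membership in \<open>D\<close> becomes membership in a linear subspace, to which the elimination
  argument applies.\<close>

lemma khol_identity: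
  assumes D: "caffine D" and F: "khol \<Omega> F"
    and \<Omega>: "open \<Omega>" "connected \<Omega>" "U \<subseteq> \<Omega>" "\<xi> \<in> \<Omega>" "\<xi> islimpt U" "w \<in> \<Omega>"
    and U: "\<And>z. z \<in> U \<Longrightarrow> F z \<in> D"
  shows "F w \<in> D"
proof -
  obtain u where "u \<in> U" using \<Omega>(5) by (auto simp: islimpt_def)
  define x0 where "x0 = F u"
  have x0: "x0 \<in> D" using U[OF \<open>u \<in> U\<close>] by (simp add: x0_def)
  have "khol \<Omega> (\<lambda>z. F z + - x0)" by (intro khol_add F khol_const)
  then obtain n f b where *: "\<And>i. f i holomorphic_on \<Omega>"
    "(\<lambda>z. F z + - x0) = (\<lambda>z. \<Sum>i<(n::nat). ksc (f i z) (b i))"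
    using khol_imp_sum by blast
  have "(\<Sum>i<n. ksc (f i w) (b i)) \<in> {x. x + x0 \<in> D}"
    using U by (intro holomorphic_sum_in_subspace[OF caffine_subspace[OF D x0] \<Omega> *(1)])
      (simp_all flip: *(2)[THEN fun_cong])
  then show ?thesis by (simp flip: *(2)[THEN fun_cong])
qed

subsection \<open>Reflections\<close>

text \<open>The field is general because the same reflections are needed over the reals and over the
  complex numbers; \<open>\<bullet>\<close> on complex vectors is real-valued and not complex
  bilinear.\<close>

definition bform :: "'a::field^'n^'n \<Rightarrow> 'a^'n \<Rightarrow> 'a^'n \<Rightarrow> 'a" where
  "bform G x y = (\<Sum>i\<in>UNIV. x $ i * (G *v y) $ i)"

text \<open>For isotropic \<open>u\<close> the division by zero gives 0, and the matrix becomes the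
  identity.\<close>

definition reflection :: "'a::field^'n^'n \<Rightarrow> 'a^'n \<Rightarrow> 'a^'n^'n" where
  "reflection G u = (\<chi> i j. (if i = j then 1 else 0) - 2 / bform G u u * u $ i * (G *v u) $ j)"

lemma bform_sum: "bform G x y = (\<Sum>i\<in>UNIV. \<Sum>j\<in>UNIV. x $ i * G $ i $ j * y $ j)"
  by (simp add: bform_def matrix_vector_mult_def sum_distrib_left mult.assoc)

lemma bform_commute: "transpose G = G \<Longrightarrow> bform G x y = bform G y x"
proof -
  assume G: "transpose G = G"
  have sym: "G $ j $ i = G $ i $ j" for i j
    using arg_cong[OF G, of "\<lambda>M. M $ i $ j"] by (simp add: transpose_def)
  have "bform G x y = (\<Sum>j\<in>UNIV. \<Sum>i\<in>UNIV. x $ i * G $ i $ j * y $ j)"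
    unfolding bform_sum by (rule sum.swap)
  also have "\<dots> = bform G y x"
    unfolding bform_sum by (intro sum.cong refl) (subst sym, simp add: mult_ac)
  finally show ?thesis .
qed

lemma bform_add_left: "bform G (x + y) w = bform G x w + bform G y w"
  and bform_diff_left: "bform G (x - y) w = bform G x w - bform G y w"
  and bform_smult_left: "bform G (c *s x) w = c * bform G x w"
  and bform_add_right: "bform G w (x + y) = bform G w x + bform G w y"
  and bform_diff_right: "bform G w (x - y) = bform G w x - bform G w y"
  and bform_smult_right: "bform G w (c *s x) = c * bform G w x"
  by (simp_all add: bform_sum algebra_simps sum.distrib sum_subtractf sum_distrib_left)

lemmas bform_simps = bform_add_left bform_diff_left bform_smult_left
  bform_add_right bform_diff_right bform_smult_right

lemma matrix_vector_axis: "((M::'a::semiring_1^'n::finite^'m) *v axis j 1) $ i = M $ i $ j"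
  by (simp add: matrix_vector_mult_def axis_def mult_delta_right)

lemma bform_axis: "bform M (axis i 1) (axis j 1) = M $ i $ j"
  by (simp add: bform_def matrix_vector_axis axis_def[of i] mult_delta_left)

lemma bform_congruence: "bform (transpose A ** G ** A) x y = bform G (A *v x) (A *v y)"
proof -
  have "bform G (A *v x) (A *v y) = (\<Sum>i\<in>UNIV. \<Sum>k\<in>UNIV. x $ k * (A $ i $ k * (G *v (A *v y)) $ i))"
    by (simp add: bform_def matrix_vector_mult_def[of A x] sum_distrib_left sum_distrib_right mult_ac)
  also have "\<dots> = (\<Sum>k\<in>UNIV. x $ k * (transpose A *v (G *v (A *v y))) $ k)"
    by (subst sum.swap) (simp add: vector_matrix_mult_def sum_distrib_left mult.commute[of "A $ _ $ _"])
  also have "\<dots> = bform (transpose A ** G ** A) x y"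
    by (simp only: bform_def matrix_vector_mul_assoc matrix_mul_assoc)
  finally show ?thesis ..
qed

lemma isometry_iff: "transpose A ** G ** A = G \<longleftrightarrow> (\<forall>x y. bform G (A *v x) (A *v y) = bform G x y)"
proof
  assume *: "\<forall>x y. bform G (A *v x) (A *v y) = bform G x y"
  have "(transpose A ** G ** A) $ i $ j = G $ i $ j" for i j
    using bform_axis[of "transpose A ** G ** A" i j] bform_axis[of G i j] *
    by (simp add: bform_congruence)
  then show "transpose A ** G ** A = G" by (simp add: vec_eq_iff)
qed (metis bform_congruence)

lemma reflection_apply:
  assumes "transpose G = G"
  shows "reflection G u *v x = x - (2 * bform G u x / bform G u u) *s u"
proof -
  have "(reflection G u *v x) $ i = x $ i - 2 * bform G x u / bform G u u * u $ i" for i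
  proof -
    have "(reflection G u *v x) $ i = (\<Sum>j\<in>UNIV. (if i = j then x $ j else 0)
        - 2 / bform G u u * u $ i * (x $ j * (G *v u) $ j))"
      by (simp add: reflection_def matrix_vector_mult_def[of "vec_lambda _"] left_diff_distrib
          mult_delta_left mult.assoc mult.commute[of "(G *v u) $ _" "x $ _"] cong: if_cong)
    also have "\<dots> = x $ i - 2 / bform G u u * u $ i * bform G x u"
      by (simp add: sum_subtractf bform_def[of G x] sum_distrib_left sum_divide_distrib)
    finally show ?thesis by simp
  qed
  then show ?thesis by (simp add: vec_eq_iff bform_commute[OF assms, of x])
qed

lemma reflection_isometry:
  assumes "transpose G = G" "bform G u u \<noteq> 0"
  shows "transpose (reflection G u) ** G ** reflection G u = G"
  unfolding isometry_iff
proof (intro allI)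
  fix x y
  show "bform G (reflection G u *v x) (reflection G u *v y) = bform G x y"
    using assms(2) bform_commute[OF assms(1), of x u]
    by (simp add: reflection_apply[OF assms(1)] bform_simps)
qed

lemma reflection_involution:
  assumes "transpose G = G" "bform G u u \<noteq> 0"
  shows "reflection G u ** reflection G u = mat 1"
proof -
  have "(reflection G u ** reflection G u) *v x = mat 1 *v x" for x
    unfolding matrix_vector_mul_assoc[symmetric] reflection_apply[OF assms(1)]
    using assms(2) by (simp add: vec_eq_iff bform_simps field_simps)
  then show ?thesis by (simp add: matrix_eq)
qed

lemma isometry_mult:
  fixes A B G :: "'a::field^'n^'n"
  shows "transpose A ** G ** A = G \<Longrightarrow> transpose B ** G ** B = G \<Longrightarrow> transpose (A ** B) ** G ** (A ** B) = G"
  unfolding isometry_iff by (simp flip: matrix_vector_mul_assoc)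

lemma isometry_det:
  fixes G :: "'a::field^'n::finite^'n"
  assumes "transpose A ** G ** A = G" "det G \<noteq> 0"
  shows "det A = 1 \<or> det A = -1"
proof -
  have "det A * det G * det A = det G"
    using arg_cong[OF assms(1), of det] by (simp add: det_mul)
  then have "det A * det A = 1" using assms(2) by (simp add: algebra_simps)
  then show ?thesis by (simp add: square_eq_1_iff)
qed

section \<open>Generation of the isometry group by reflections\<close>

inductive_set reflection_products :: "'a::field^'n^'n \<Rightarrow> ('a^'n^'n) set" for G where
  one: "mat 1 \<in> reflection_products G"
| mult: "bform G u u \<noteq> 0 \<Longrightarrow> A \<in> reflection_products G \<Longrightarrow> reflection G u ** A \<in> reflection_products G"

text \<open>A single reflection has determinant -1, so only products of an even number of them can
  be joined to the identity; hence generation by pairs.\<close>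

inductive_set reflection_pair_products :: "'a::field^'n^'n \<Rightarrow> ('a^'n^'n) set" for G where
  one: "mat 1 \<in> reflection_pair_products G"
| mult: "bform G u u \<noteq> 0 \<Longrightarrow> bform G v v \<noteq> 0 \<Longrightarrow> A \<in> reflection_pair_products G
    \<Longrightarrow> reflection G v ** reflection G u ** A \<in> reflection_pair_products G"

lemma reflection_cancel:
  assumes "transpose G = G" "bform G u u \<noteq> 0"
  shows "reflection G u ** (reflection G u ** A) = A"
  by (simp add: matrix_mul_assoc reflection_involution[OF assms])

text \<open>One of \<open>w - p\<close> and \<open>w + p\<close> is anisotropic, and the reflection in it maps \<open>w\<close> to \<open>p\<close> or \<open>-p\<close>.\<close>

lemma reflections_between:
  fixes G :: "'a::field_char_0^'n^'n"
  assumes G: "transpose G = G" and "bform G w w = bform G p p" "bform G p p \<noteq> 0"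
  shows "bform G (w - p) (w - p) \<noteq> 0 \<and> reflection G (w - p) *v w = p \<or>
    bform G (w + p) (w + p) \<noteq> 0 \<and> reflection G p *v (reflection G (w + p) *v w) = p"
proof -
  have q1: "bform G (w - p) (w - p) = 2 * (bform G p p - bform G p w)"
    and q2: "bform G (w + p) (w + p) = 2 * (bform G p p + bform G p w)"
    using assms by (simp_all add: bform_simps bform_commute[OF G, of w p])
  show ?thesis
  proof (cases "bform G (w - p) (w - p) = 0")
    case False
    then have "bform G p p - bform G p w \<noteq> 0" unfolding q1 by (metis mult_zero_right)
    then have "reflection G (w - p) *v w = p"
      unfolding reflection_apply[OF G] q1
      by (simp add: vec_eq_iff bform_simps assms(2) bform_commute[OF G, of w p])
    then show ?thesis using False by blast
  next
    case True
    \<comment> \<open>The two values add up to \<open>4 * bform G p p\<close>, which is nonzero, so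
      they cannot both vanish.\<close>
    then have nz: "bform G (w + p) (w + p) \<noteq> 0" using q1 q2 assms(3) by auto
    from this have "bform G p p + bform G p w \<noteq> 0" unfolding q2 by (metis mult_zero_right)
    moreover have "2 * bform G p p + 2 * bform G p w \<noteq> 0" using nz unfolding q2 distrib_left .
    ultimately have "reflection G (w + p) *v w = - p"
      unfolding reflection_apply[OF G] q2
      by (simp add: vec_eq_iff bform_simps assms(2) add.commute bform_commute[OF G, of w p])
    then have "reflection G p *v (reflection G (w + p) *v w) = p"
    proof -
      have "bform G p (- p) = - bform G p p" by (simp add: bform_sum sum_negf)
      then have "reflection G p *v (- p) = p"
        using assms(3) by (simp add: reflection_apply[OF G] vec_eq_iff)
      then show ?thesis using \<open>reflection G (w + p) *v w = - p\<close> by simp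
    qed
    with nz show ?thesis by blast
  qed
qed

text \<open>The generation part of the Cartan-Dieudonne theorem. The induction runs over the set of
  orthogonal basis vectors that may still be moved: one or two reflections bring the image of a
  basis vector back to it without disturbing those already fixed.\<close>

lemma isometry_in_reflection_products:
  fixes G P :: "'a::field_char_0^'n::finite^'n"
  assumes G: "transpose G = G" and P: "invertible P"
    and diag: "\<And>i j. i \<noteq> j \<Longrightarrow> bform G (P *v axis i 1) (P *v axis j 1) = 0"
    and nz: "\<And>i. bform G (P *v axis i 1) (P *v axis i 1) \<noteq> 0"
    and "transpose A ** G ** A = G"
  shows "A \<in> reflection_products G"
proof -
  define p where "p i = P *v axis i 1" for i
  have "A \<in> reflection_products G" if "finite I" "transpose A ** G ** A = G" "\<forall>i. i \<notin> I \<longrightarrow> A *v p i = p i" for I A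
    using that
  proof (induction I arbitrary: A)
    case empty
    have "(A ** P) *v axis i 1 = P *v axis i 1" for i
      using empty(2) by (simp add: p_def flip: matrix_vector_mul_assoc)
    then have "A ** P = P"
      by (simp add: vec_eq_iff matrix_vector_axis)
    then have *: "A ** (P ** P') = P ** P'" for P' by (simp only: matrix_mul_assoc)
    obtain P' where "P ** P' = mat 1" using P by (auto simp: invertible_def)
    with *[of P'] have "A = mat 1" by simp
    then show ?case by (simp add: reflection_products.one)
  next
    case (insert k I)
    have iso: "bform G (A *v x) (A *v y) = bform G x y" for x y
      using insert.prems(1) by (simp add: isometry_iff)
    \<comment> \<open>\<open>A\<close> fixes \<open>p i\<close>, so \<open>A *v p k\<close> stays
      orthogonal to it. Then \<open>A *v p k - p k\<close> and \<open>A *v p k + p k\<close> are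
      orthogonal to \<open>p i\<close> as well, and the reflections in them fix
      \<open>p i\<close>.\<close>
    have orth: "bform G (A *v p k) (p i) = 0" if "i \<notin> insert k I" for i
      using iso[of "p k" "p i"] insert.prems(2) that diag[of k i] by (auto simp: p_def)
    have orth': "bform G (p k) (p i) = 0" if "i \<notin> insert k I" for i
      using diag[of k i] that by (auto simp: p_def)
    have nk: "bform G (p k) (p k) \<noteq> 0" using nz by (simp add: p_def)
    consider (one) u where "bform G u u \<noteq> 0" "reflection G u *v (A *v p k) = p k" "u = A *v p k - p k"
      | (two) u where "bform G u u \<noteq> 0" "reflection G (p k) *v (reflection G u *v (A *v p k)) = p k" "u = A *v p k + p k"
      using reflections_between[OF G iso nk] by blast
    then show ?case
    proof cases
      case one
      have "reflection G u ** A \<in> reflection_products G"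
      proof (rule insert.IH)
        show "transpose (reflection G u ** A) ** G ** (reflection G u ** A) = G"
          by (rule isometry_mult[OF reflection_isometry[OF G one(1)] insert.prems(1)])
        show "\<forall>i. i \<notin> I \<longrightarrow> (reflection G u ** A) *v p i = p i"
        proof (intro allI impI)
          fix i assume "i \<notin> I"
          show "(reflection G u ** A) *v p i = p i"
          proof (cases "i = k")
            case False
            with \<open>i \<notin> I\<close> have "i \<notin> insert k I" by simp
            then show ?thesis
              using insert.prems(2) orth[of i] orth'[of i]
              by (simp add: one(3) bform_simps reflection_apply[OF G] flip: matrix_vector_mul_assoc)
          qed (simp add: one(2) flip: matrix_vector_mul_assoc)
        qed
      qed
      from reflection_products.mult[OF one(1) this] show ?thesis
        by (simp add: reflection_cancel[OF G one(1)])
    next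
      case two
      define B where "B = reflection G (p k) ** (reflection G u ** A)"
      have "B \<in> reflection_products G"
      proof (rule insert.IH)
        show "transpose B ** G ** B = G"
          unfolding B_def
          by (intro isometry_mult reflection_isometry G two(1) nk insert.prems(1))
        show "\<forall>i. i \<notin> I \<longrightarrow> B *v p i = p i"
        proof (intro allI impI)
          fix i assume "i \<notin> I"
          show "B *v p i = p i"
          proof (cases "i = k")
            case False
            with \<open>i \<notin> I\<close> have "i \<notin> insert k I" by simp
            then show ?thesis
              using insert.prems(2) orth[of i] orth'[of i]
              by (simp add: B_def two(3) bform_simps reflection_apply[OF G] flip: matrix_vector_mul_assoc)
          qed (simp add: B_def two(2) flip: matrix_vector_mul_assoc)
        qed
      qed
      from reflection_products.mult[OF two(1) reflection_products.mult[OF nk this]] show ?thesis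
        by (simp add: B_def reflection_cancel[OF G nk] reflection_cancel[OF G two(1)])
    qed
  qed
  \<comment> \<open>With \<open>I = UNIV\<close> the condition on fixed vectors is vacuous.\<close>
  from this[of UNIV A] show ?thesis using assms by simp
qed

text \<open>Parity relative to one fixed reflection: an extra reflection in front of an even product
  is absorbed by inserting the square of \<open>reflection G p\<close>, which is the
  identity.\<close>

lemma reflection_products_cases:
  assumes G: "transpose G = G" and p: "bform G p p \<noteq> 0" and "A \<in> reflection_products G"
  shows "A \<in> reflection_pair_products G \<or> (\<exists>B\<in>reflection_pair_products G. A = reflection G p ** B)"
  using assms(3)
proof induction
  case one
  then show ?case using reflection_pair_products.one by blast
next
  case (mult u A)
  from mult.IH show ?case
  proof
    assume A: "A \<in> reflection_pair_products G"
    have "reflection G u ** A = reflection G p ** (reflection G p ** reflection G u ** A)"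
      by (simp add: reflection_cancel[OF G p] flip: matrix_mul_assoc)
    then show ?thesis using reflection_pair_products.mult[OF mult(1) p A] by blast
  next
    assume "\<exists>B\<in>reflection_pair_products G. A = reflection G p ** B"
    then obtain B where B: "B \<in> reflection_pair_products G" "A = reflection G p ** B" by blast
    then show ?thesis
      using reflection_pair_products.mult[OF p mult(1) B(1)] by (simp add: matrix_mul_assoc)
  qed
qed

text \<open>In the orthogonal basis formed by the columns of \<open>P\<close> the reflection is
  diagonal, with -1 at \<open>t\<close> and 1 elsewhere.\<close>

lemma det_reflection_basis:
  fixes G P :: "'a::field_char_0^'n::finite^'n"
  assumes G: "transpose G = G" and P: "invertible P"
    and diag: "\<And>i j. i \<noteq> j \<Longrightarrow> bform G (P *v axis i 1) (P *v axis j 1) = 0"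
    and nz: "bform G (P *v axis t 1) (P *v axis t 1) \<noteq> 0"
  shows "det (reflection G (P *v axis t 1)) = -1"
proof -
  define D where "D = ((\<chi> i j. if i = j then if i = t then -1 else 1 else 0) :: 'a^'n^'n)"
  have "(reflection G (P *v axis t 1) ** P) *v axis j 1 = (P ** D) *v axis j 1" for j
  proof -
    have "D *v axis j 1 = (if j = t then -1 else 1) *s axis j 1"
      unfolding vec_eq_iff matrix_vector_axis by (auto simp: D_def axis_def)
    then have "(P ** D) *v axis j 1 = (if j = t then -1 else 1) *s (P *v axis j 1)"
      by (simp add: vector_scalar_commute flip: matrix_vector_mul_assoc)
    then show ?thesis
      using diag[of t j] nz
      by (cases "j = t") (simp_all add: reflection_apply[OF G] vec_eq_iff flip: matrix_vector_mul_assoc)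
  qed
  then have "reflection G (P *v axis t 1) ** P = P ** D"
    by (simp add: vec_eq_iff matrix_vector_axis)
  then have "det (reflection G (P *v axis t 1)) * det P = det P * det D"
    by (simp flip: det_mul)
  moreover have "det D = -1"
    by (subst det_diagonal) (auto simp: D_def prod.delta)
  moreover have "det P \<noteq> 0"
    using P by (simp add: invertible_det_nz)
  ultimately show ?thesis
    using mult_right_cancel[of "det P" "det (reflection G (P *v axis t 1))" "- 1"] by simp
qed

subsection \<open>Complex curves of Lorentz transformations\<close>

definition cvec :: "real^'n \<Rightarrow> complex^'n" where
  "cvec x = (\<chi> i. complex_of_real (x $ i))"

lemma cmat_mult: "cmat (A ** B) = cmat A ** cmat B"
  by (simp add: cmat_def matrix_matrix_mult_def vec_eq_iff)

lemma transpose_cmat: "transpose (cmat A) = cmat (transpose A)"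
  by (simp add: cmat_def transpose_def vec_eq_iff)

lemma det_cmat: "det (cmat A) = complex_of_real (det A)"
  by (simp add: det_def cmat_def)

lemma bform_cmat: "bform (cmat G) (cvec x) (cvec y) = complex_of_real (bform G x y)"
  by (simp add: bform_sum cmat_def cvec_def)

lemma cmat_reflection: "cmat (reflection G u) = reflection (cmat G) (cvec u)"
  unfolding reflection_def[of "cmat G"] bform_cmat
  by (simp add: reflection_def vec_eq_iff cmat_def cvec_def matrix_vector_mult_def)

lemma bounded_linear_single_entry:
  "bounded_linear (\<lambda>z::complex. (\<chi> k l. if k = i \<and> l = j then z else 0) :: complex^'n::finite^'m::finite)"
  by (intro linear_conv_bounded_linear[THEN iffD1] linearI) (auto simp: vec_eq_iff)

text \<open>A matrix is the sum of its single-entry parts, each bounded linear in its entry, so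
  entrywise complex derivatives assemble. Writing the result with \<open>cmat_scale\<close> makes
  its complex linearity visible.\<close>

lemma has_derivative_matrix:
  fixes A :: "complex \<Rightarrow> complex^'n::finite^'m::finite"
  assumes "\<And>i j. ((\<lambda>z. A z $ i $ j) has_field_derivative A' $ i $ j) (at z)"
  shows "(A has_derivative (\<lambda>h. cmat_scale h A')) (at z)"
proof -
  have expand: "B = (\<Sum>i\<in>UNIV. \<Sum>j\<in>UNIV. (\<chi> k l. if k = i \<and> l = j then B $ i $ j else 0))"
    for B :: "complex^'n^'m"
  proof -
    have "(\<Sum>i\<in>UNIV. \<Sum>j\<in>UNIV. if k = i \<and> l = j then B $ i $ j else 0) = B $ k $ l" for k l
    proof -
      have "(\<Sum>i\<in>UNIV. \<Sum>j\<in>UNIV. if k = i \<and> l = j then B $ i $ j else 0)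
          = (\<Sum>i\<in>UNIV. if k = i then (\<Sum>j\<in>UNIV. if l = j then B $ i $ j else 0) else 0)"
        by (intro sum.cong) auto
      then show ?thesis by simp
    qed
    then show ?thesis by (simp add: vec_eq_iff)
  qed
  have "((\<lambda>z. \<Sum>i\<in>UNIV. \<Sum>j\<in>UNIV. (\<chi> k l. if k = i \<and> l = j then A z $ i $ j else 0) :: complex^'n^'m) has_derivative
      (\<lambda>h. \<Sum>i\<in>UNIV. \<Sum>j\<in>UNIV. (\<chi> k l. if k = i \<and> l = j then A' $ i $ j * h else 0))) (at z)"
    using assms unfolding has_field_derivative_def
    by (intro has_derivative_sum bounded_linear.has_derivative[OF bounded_linear_single_entry])
  moreover have "(\<Sum>i\<in>UNIV. \<Sum>j\<in>UNIV. (\<chi> k l. if k = i \<and> l = j then A z $ i $ j else 0)) = A z" for z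
    by (rule expand[symmetric])
  moreover have "(\<Sum>i\<in>UNIV. \<Sum>j\<in>UNIV. (\<chi> k l. if k = i \<and> l = j then A' $ i $ j * h else 0)) = cmat_scale h A'" for h
  proof -
    have "cmat_scale h A' $ i $ j = A' $ i $ j * h" for i j by (simp add: cmat_scale_def)
    from expand[of "cmat_scale h A'", unfolded this] show ?thesis by (rule sym)
  qed
  ultimately show ?thesis by (simp only:)
qed

text \<open>Chain rule through the local ambient extension of \<open>F\<close>, which agrees with
  \<open>F\<close> along the curve because the curve stays in \<open>S\<close>.\<close>

lemma holo_on_compose:
  fixes A :: "complex \<Rightarrow> complex^'n::finite^'n" and F :: "complex^'n^'n \<Rightarrow> complex^'m::finite^'m"
  assumes F: "holo_on S F" and \<Omega>: "open \<Omega>"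
    and A: "\<And>i j. (\<lambda>z. A z $ i $ j) holomorphic_on \<Omega>" and S: "\<And>z. z \<in> \<Omega> \<Longrightarrow> A z \<in> S"
  shows "(\<lambda>z. F (A z) $ i $ j) holomorphic_on \<Omega>"
  unfolding holomorphic_on_open[OF \<Omega>]
proof
  fix z assume z: "z \<in> \<Omega>"
  define A' :: "complex^'n^'n" where "A' = (\<chi> i j. deriv (\<lambda>z. A z $ i $ j) z)"
  have A': "(A has_derivative (\<lambda>h. cmat_scale h A')) (at z)"
    by (rule has_derivative_matrix) (simp add: A'_def holomorphic_derivI[OF A \<Omega> z])
  obtain U Fe where U: "open U" "A z \<in> U" "\<forall>y\<in>U \<inter> S. Fe y = F y"
    "\<forall>y\<in>U. \<exists>f'. (Fe has_derivative f') (at y) \<and> (\<forall>h. f' (cmat_scale \<i> h) = cmat_scale \<i> (f' h))"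
    using F S[OF z] unfolding holo_on_def by meson
  then obtain f' where f': "(Fe has_derivative f') (at (A z))" "\<And>h. f' (cmat_scale \<i> h) = cmat_scale \<i> (f' h)"
    by meson
  have lin: "linear f'" using f'(1) has_derivative_linear by blast
  \<comment> \<open>A priori \<open>f'\<close> is only real linear; commuting with multiplication by
    \<open>\<i>\<close> makes it complex linear.\<close>
  have scale: "f' (cmat_scale h B) = cmat_scale h (f' B)" for h B
  proof -
    have split: "cmat_scale h B = Re h *\<^sub>R B + Im h *\<^sub>R cmat_scale \<i> B" for B :: "complex^'k::finite^'k"
      by (simp add: cmat_scale_def vec_eq_iff complex_eq_iff)
    show ?thesis
      unfolding split[of B] split[of "f' B"] by (simp add: linear_add[OF lin] linear_scale[OF lin] f'(2))
  qed
  have "((\<lambda>z. Fe (A z)) has_derivative (\<lambda>h. cmat_scale h (f' A'))) (at z)"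
    using has_derivative_compose[OF A' f'(1)] by (simp add: scale)
  from bounded_linear.has_derivative[OF bounded_linear_compose[OF bounded_linear_vec_nth[of j] bounded_linear_vec_nth[of i]] this]
  have "((\<lambda>z. Fe (A z) $ i $ j) has_derivative (\<lambda>h. h * f' A' $ i $ j)) (at z)"
    by (simp add: cmat_scale_def)
  then have "((\<lambda>z. Fe (A z) $ i $ j) has_field_derivative f' A' $ i $ j) (at z)"
    by (simp add: has_field_derivative_def mult.commute[of _ "f' A' $ i $ j"])
  moreover have "continuous_on \<Omega> (\<lambda>z. \<chi> i j. A z $ i $ j)"
    by (intro continuous_on_vec_lambda holomorphic_on_imp_continuous_on A)
  then have "open (\<Omega> \<inter> A -` U)"
    using continuous_open_preimage[OF _ \<Omega> U(1), of A] by simp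
  moreover have "z \<in> \<Omega> \<inter> A -` U" using z U(2) by simp
  moreover have "\<And>y. y \<in> \<Omega> \<inter> A -` U \<Longrightarrow> Fe (A y) $ i $ j = F (A y) $ i $ j"
    using U(3) S by simp
  ultimately show "\<exists>f'. ((\<lambda>z. F (A z) $ i $ j) has_field_derivative f') (at z)"
    by (intro exI) (rule has_field_derivative_transform_within_open)
qed

lemma holomorphic_on_cnj_cnj:
  assumes "f holomorphic_on S" "open S" "\<And>z. z \<in> S \<Longrightarrow> cnj z \<in> S"
  shows "(\<lambda>z. cnj (f (cnj z))) holomorphic_on S"
proof -
  have "\<exists>f'. ((cnj \<circ> f \<circ> cnj) has_field_derivative f') (at z)" if z: "z \<in> S" for z
  proof -
    obtain D where "(f has_field_derivative D) (at (cnj z))"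
      using assms(1) assms(3)[OF z] unfolding holomorphic_on_open[OF assms(2)] by blast
    then show ?thesis using has_field_derivative_cnj_cnj[of f D z] by blast
  qed
  then show ?thesis by (simp add: holomorphic_on_open[OF assms(2)] o_def)
qed

lemma islimpt_real_interval:
  assumes "0 < e"
  shows "(0::complex) islimpt complex_of_real ` {0..e}"
  unfolding islimpt_approachable
proof (intro allI impI)
  fix d :: real assume "0 < d"
  with assms show "\<exists>x'\<in>complex_of_real ` {0..e}. x' \<noteq> 0 \<and> dist x' 0 < d"
    by (intro bexI[of _ "complex_of_real (min e (d / 2))"]) (auto simp: min_def)
qed

section \<open>The complex curve attached to a pair of reflections\<close>

locale reflection_curve =
  fixes G :: "real^'n::finite^'n" and u v :: "real^'n"
  assumes sym: "transpose G = G" and det: "det G \<noteq> 0"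
    and u: "bform G u u \<noteq> 0" and v: "bform G v v \<noteq> 0"
begin

definition seg :: "complex \<Rightarrow> complex^'n" where
  "seg z = cvec u + z *s cvec (v - u)"

text \<open>When \<open>bform G u u\<close> and \<open>bform G v v\<close> have opposite signs, the
  real segment from \<open>u\<close> to \<open>v\<close> meets an isotropic vector, where the
  reflection breaks down. Complex parameters allow a way around such points.\<close>

definition param_dom :: "complex set" where
  "param_dom = {z. bform (cmat G) (seg z) (seg z) \<noteq> 0}"

definition curve :: "complex \<Rightarrow> complex^'n^'n" where
  "curve z = reflection (cmat G) (seg z) ** reflection (cmat G) (cvec u)"

text \<open>The inverse group element enters the action through \<open>\<rho>\<close>; the reversed
  product keeps it manifestly rational in \<open>z\<close>.\<close>

definition curve_inv :: "complex \<Rightarrow> complex^'n^'n" where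
  "curve_inv z = reflection (cmat G) (cvec u) ** reflection (cmat G) (seg z)"

definition rcurve :: "real \<Rightarrow> real^'n^'n" where
  "rcurve t = reflection G (u + t *s (v - u)) ** reflection G u"

definition rcurve_inv :: "real \<Rightarrow> real^'n^'n" where
  "rcurve_inv t = reflection G u ** reflection G (u + t *s (v - u))"

lemma seg_of_real: "seg (of_real t) = cvec (u + t *s (v - u))"
  by (simp add: seg_def cvec_def vec_eq_iff right_diff_distrib)

lemma seg_0: "seg 0 = cvec u"
  by (simp add: seg_def)

lemma of_real_in_param_dom: "of_real t \<in> param_dom \<longleftrightarrow> bform G (u + t *s (v - u)) (u + t *s (v - u)) \<noteq> 0"
  by (simp add: param_dom_def seg_of_real bform_cmat)

lemma param_dom_0_1: "0 \<in> param_dom" "1 \<in> param_dom"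
  using of_real_in_param_dom[of 0] of_real_in_param_dom[of 1] u v by simp_all

lemma curve_of_real: "curve (of_real t) = cmat (rcurve t)" "curve_inv (of_real t) = cmat (rcurve_inv t)"
  by (simp_all add: curve_def curve_inv_def rcurve_def rcurve_inv_def cmat_mult cmat_reflection seg_of_real)

text \<open>The excluded parameters are the roots of a polynomial of degree at most two whose
  constant coefficient \<open>bform G u u\<close> is nonzero.\<close>

lemma finite_compl_param_dom: "finite (- param_dom)"
proof -
  let ?G = "cmat G" and ?u = "cvec u" and ?w = "cvec (v - u)"
  let ?p = "[:bform ?G ?u ?u, bform ?G ?u ?w + bform ?G ?w ?u, bform ?G ?w ?w:]"
  have "- param_dom = {z. poly ?p z = 0}"
    by (auto simp: param_dom_def seg_def bform_simps algebra_simps)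
  moreover have "?p \<noteq> 0" using u by (simp add: bform_cmat)
  ultimately show ?thesis using poly_roots_finite by metis
qed

lemma open_param_dom: "open param_dom"
  using finite_compl_param_dom finite_imp_closed[of "- param_dom"] by (simp add: closed_def)

lemma connected_param_dom: "connected param_dom"
  using connected_open_delete_finite[of UNIV "- param_dom"] finite_compl_param_dom
  by (simp add: connected_UNIV Diff_eq)

text \<open>The form and both endpoints are real. This symmetry of the domain is what Schwarz
  reflection requires.\<close>

lemma cnj_param_dom:
  assumes "z \<in> param_dom"
  shows "cnj z \<in> param_dom"
proof -
  have "bform (cmat G) (seg (cnj z)) (seg (cnj z)) = cnj (bform (cmat G) (seg z) (seg z))"
    by (simp add: bform_sum seg_def cvec_def cmat_def)
  then show ?thesis using assms by (simp add: param_dom_def)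
qed

lemma holomorphic_reflection_seg: "(\<lambda>z. reflection (cmat G) (seg z) $ i $ j) holomorphic_on param_dom"
proof -
  have seg: "(\<lambda>z. seg z $ i) holomorphic_on param_dom" for i
    unfolding seg_def by (simp add: holomorphic_intros)
  have mv: "(\<lambda>z. (cmat G *v seg z) $ i) holomorphic_on param_dom" for i
    unfolding matrix_vector_mult_def by (simp, intro holomorphic_intros seg)
  have b: "(\<lambda>z. bform (cmat G) (seg z) (seg z)) holomorphic_on param_dom"
    unfolding bform_def by (intro holomorphic_intros seg mv)
  have "(\<lambda>z. (if i = j then 1 else 0) - 2 / bform (cmat G) (seg z) (seg z) * seg z $ i * (cmat G *v seg z) $ j)
      holomorphic_on param_dom"
    by (intro holomorphic_intros seg mv b) (auto simp: param_dom_def)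
  then show ?thesis by (simp add: reflection_def)
qed

lemma holomorphic_curve:
  "(\<lambda>z. curve z $ i $ j) holomorphic_on param_dom" "(\<lambda>z. curve_inv z $ i $ j) holomorphic_on param_dom"
  unfolding curve_def curve_inv_def matrix_matrix_mult_def
  by (simp_all, (intro holomorphic_intros holomorphic_reflection_seg)+)

lemma curve_mult:
  assumes "z \<in> param_dom"
  shows "curve z ** curve_inv z = mat 1" "curve_inv z ** curve z = mat 1"
proof -
  have sC: "transpose (cmat G) = cmat G" by (simp add: transpose_cmat sym)
  have inv: "reflection (cmat G) (seg z) ** reflection (cmat G) (seg z) = mat 1"
    "reflection (cmat G) (cvec u) ** reflection (cmat G) (cvec u) = mat 1"
    using assms u by (auto intro!: reflection_involution[OF sC] simp: param_dom_def bform_cmat)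
  show "curve z ** curve_inv z = mat 1" "curve_inv z ** curve z = mat 1"
    by (metis inv matrix_mul_assoc matrix_mul_lid curve_def curve_inv_def)+
qed

lemma curve_isometry:
  assumes "z \<in> param_dom"
  shows "transpose (curve z) ** cmat G ** curve z = cmat G"
    "transpose (curve_inv z) ** cmat G ** curve_inv z = cmat G"
proof -
  have sC: "transpose (cmat G) = cmat G" by (simp add: transpose_cmat sym)
  show "transpose (curve z) ** cmat G ** curve z = cmat G"
    "transpose (curve_inv z) ** cmat G ** curve_inv z = cmat G"
    unfolding curve_def curve_inv_def using assms u
    by (auto intro!: isometry_mult reflection_isometry[OF sC] simp: param_dom_def bform_cmat)
qed

text \<open>The determinant takes only the values 1 and -1 on a connected domain, so it is constant,
  and at 0 the curve is the square of a reflection.\<close>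

lemma det_curve:
  assumes "z \<in> param_dom"
  shows "det (curve z) = 1"
proof -
  have "(\<lambda>z. det (curve z)) holomorphic_on param_dom"
    unfolding det_def by (intro holomorphic_intros holomorphic_curve)
  then have "connected ((\<lambda>z. det (curve z)) ` param_dom)"
    using connected_continuous_image connected_param_dom holomorphic_on_imp_continuous_on by blast
  moreover have sub: "(\<lambda>z. det (curve z)) ` param_dom \<subseteq> {1, -1}"
    using isometry_det[OF curve_isometry(1)] det by (auto simp: det_cmat)
  then have "finite ((\<lambda>z. det (curve z)) ` param_dom)" by (rule finite_subset) simp
  ultimately obtain c where c: "(\<lambda>z. det (curve z)) ` param_dom \<subseteq> {c}"
    using connected_finite_iff_sing by (metis empty_subsetI subset_refl)
  have "curve 0 = mat 1"
    unfolding curve_def seg_0 using u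
    by (intro reflection_involution) (simp_all add: transpose_cmat sym bform_cmat)
  then have "det (curve 0) = 1" by simp
  then show ?thesis using c param_dom_0_1(1) assms by (metis image_subset_iff singletonD)
qed

lemma det_curve_inv: "z \<in> param_dom \<Longrightarrow> det (curve_inv z) = 1"
  by (metis det_I det_mul det_curve mult_1 curve_mult(1))

lemma curve_in_L_plus_C: "z \<in> param_dom \<Longrightarrow> curve z \<in> L_plus_C G" "z \<in> param_dom \<Longrightarrow> curve_inv z \<in> L_plus_C G"
  by (simp_all add: L_plus_C_def curve_isometry det_curve det_curve_inv)

lemma rcurve_mult:
  assumes "of_real t \<in> param_dom"
  shows "rcurve t ** rcurve_inv t = mat 1" "rcurve_inv t ** rcurve t = mat 1"
proof -
  have inv: "reflection G (u + t *s (v - u)) ** reflection G (u + t *s (v - u)) = mat 1"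
    "reflection G u ** reflection G u = mat 1"
    using assms u by (auto intro!: reflection_involution[OF sym] simp: of_real_in_param_dom)
  show "rcurve t ** rcurve_inv t = mat 1" "rcurve_inv t ** rcurve t = mat 1"
    by (metis inv matrix_mul_assoc matrix_mul_lid rcurve_def rcurve_inv_def)+
qed

lemma rcurve_in_lorentz_group:
  "of_real t \<in> param_dom \<Longrightarrow> rcurve t \<in> lorentz_group G" "of_real t \<in> param_dom \<Longrightarrow> rcurve_inv t \<in> lorentz_group G"
  using u by (auto simp: lorentz_group_def rcurve_def rcurve_inv_def of_real_in_param_dom
      intro!: isometry_mult reflection_isometry[OF sym])

lemma continuous_rcurve:
  assumes "\<And>t. t \<in> T \<Longrightarrow> of_real t \<in> param_dom"
  shows "continuous_on T rcurve" "continuous_on T rcurve_inv"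
  unfolding rcurve_def rcurve_inv_def matrix_matrix_mult_def reflection_def bform_def matrix_vector_mult_def
  using assms unfolding of_real_in_param_dom bform_def matrix_vector_mult_def
  by (auto intro!: continuous_intros)

lemma interval_in_param_dom: "\<exists>e>0. \<forall>t\<in>{0..e}. of_real t \<in> param_dom"
proof -
  obtain e where "e > 0" "cball 0 e \<subseteq> param_dom"
    using open_param_dom param_dom_0_1(1) open_contains_cball by blast
  then show ?thesis by (intro exI[of _ e]) (auto simp: subset_iff)
qed

text \<open>The image of the interval is a connected set of Lorentz transformations, and it contains
  the identity as the value at 0.\<close>

lemma rcurve_in_L_up:
  assumes "\<And>s. s \<in> {0..e} \<Longrightarrow> of_real s \<in> param_dom" "t \<in> {0..e}"
  shows "rcurve t \<in> L_up G" "rcurve_inv t \<in> L_up G"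
proof -
  have 0: "0 \<in> {0..e}" using assms(2) by simp
  have "rcurve 0 = mat 1" "rcurve_inv 0 = mat 1"
    using reflection_involution[OF sym u] by (simp_all add: rcurve_def rcurve_inv_def)
  then have 1: "mat 1 \<in> rcurve ` {0..e}" "mat 1 \<in> rcurve_inv ` {0..e}"
    using 0 by (metis imageI)+
  have "connected (rcurve ` {0..e})" "connected (rcurve_inv ` {0..e})"
    using continuous_rcurve[of "{0..e}"] assms(1) by (auto intro!: connected_continuous_image)
  moreover have "rcurve ` {0..e} \<subseteq> lorentz_group G" "rcurve_inv ` {0..e} \<subseteq> lorentz_group G"
    using rcurve_in_lorentz_group assms(1) by auto
  ultimately show "rcurve t \<in> L_up G" "rcurve_inv t \<in> L_up G"
    using 1 assms(2) unfolding L_up_def connected_component_def mem_Collect_eq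
    by (metis imageI)+
qed

text \<open>Schwarz reflection: the extension is real on the curve for small real parameters.\<close>

lemma extension_real:
  assumes ext: "holo_extension G r rC" and t: "of_real t \<in> param_dom"
  shows "rC (curve (of_real t)) = cmat (real_restr rC (rcurve t))"
    "rC (curve_inv (of_real t)) = cmat (real_restr rC (rcurve_inv t))"
proof -
  obtain e where e: "e > 0" "\<And>t. t \<in> {0..e} \<Longrightarrow> of_real t \<in> param_dom"
    using interval_in_param_dom by blast
  have holo: "holo_on (L_plus_C G) rC" and up: "\<And>A. A \<in> L_up G \<Longrightarrow> rC (cmat A) = cmat (r A)"
    using ext by (auto simp: holo_extension_def)
  have near: "rC (curve (of_real s)) = cmat (r (rcurve s))" "rC (curve_inv (of_real s)) = cmat (r (rcurve_inv s))"
    if s: "s \<in> {0..e}" for s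
    using up[OF rcurve_in_L_up(1)[OF e(2) s]] up[OF rcurve_in_L_up(2)[OF e(2) s]]
    by (simp_all add: curve_of_real)
  have Im_cmat: "Im (cmat M $ i $ j) = 0" for M i j by (simp add: cmat_def)
  have real: "Im (f (of_real t)) = 0" if f: "f holomorphic_on param_dom"
    and fU: "\<And>s. s \<in> {0..e} \<Longrightarrow> Im (f (of_real s)) = 0" for f
  proof -
    \<comment> \<open>At real points this difference is \<open>2 * \<i>\<close> times the imaginary
      part of \<open>f\<close>. Its vanishing on \<open>{0..e}\<close> continues analytically to
      \<open>t\<close>, even when excluded real parameters lie in between.\<close>
    have "f (of_real t) - cnj (f (cnj (of_real t))) = 0"
    proof (rule analytic_continuation[of "\<lambda>z. f z - cnj (f (cnj z))", OF _ open_param_dom connected_param_dom])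
      show "(\<lambda>z. f z - cnj (f (cnj z))) holomorphic_on param_dom"
        by (intro holomorphic_intros f holomorphic_on_cnj_cnj open_param_dom cnj_param_dom)
      show "complex_of_real ` {0..e} \<subseteq> param_dom" using e(2) by blast
      show "f z - cnj (f (cnj z)) = 0" if "z \<in> complex_of_real ` {0..e}" for z
        using that fU by (auto simp: complex_eq_iff)
    qed (use t param_dom_0_1 islimpt_real_interval[OF e(1)] in auto)
    then show ?thesis by (simp add: complex_eq_iff)
  qed
  have "Im (rC (curve (of_real t)) $ i $ j) = 0" for i j
    by (rule real[OF holo_on_compose[OF holo open_param_dom holomorphic_curve(1) curve_in_L_plus_C(1)]])
      (simp_all add: near Im_cmat del: atLeastAtMost_iff)
  then show "rC (curve (of_real t)) = cmat (real_restr rC (rcurve t))"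
    by (simp add: curve_of_real real_restr_def cmat_def[of "vec_lambda _"] vec_eq_iff complex_eq_iff)
  have "Im (rC (curve_inv (of_real t)) $ i $ j) = 0" for i j
    by (rule real[OF holo_on_compose[OF holo open_param_dom holomorphic_curve(2) curve_in_L_plus_C(2)]])
      (simp_all add: near Im_cmat del: atLeastAtMost_iff)
  then show "rC (curve_inv (of_real t)) = cmat (real_restr rC (rcurve_inv t))"
    by (simp add: curve_of_real real_restr_def cmat_def[of "vec_lambda _"] vec_eq_iff complex_eq_iff)
qed

lemma rcurve_in_L_plus:
  assumes "of_real t \<in> param_dom"
  shows "rcurve t \<in> L_plus G"
  using det_curve[OF assms] rcurve_in_lorentz_group(1)[OF assms]
  by (simp add: L_plus_def curve_of_real det_cmat)

lemma matrix_inv_rcurve: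
  assumes "of_real t \<in> param_dom"
  shows "matrix_inv (rcurve t) = rcurve_inv t"
proof -
  have "\<exists>B. rcurve t ** B = mat 1 \<and> B ** rcurve t = mat 1"
    using rcurve_mult[OF assms] by blast
  then have "rcurve t ** matrix_inv (rcurve t) = mat 1"
    unfolding matrix_inv_def by (rule someI2_ex) blast
  then have "rcurve_inv t ** (rcurve t ** matrix_inv (rcurve t)) = rcurve_inv t" by simp
  then show ?thesis by (simp add: matrix_mul_assoc rcurve_mult[OF assms])
qed

end

subsection \<open>Invariance\<close>

lemma classical_action_eq_induced_action:
  assumes "classical_action S r w \<sigma>" "g \<in> S"
  shows "\<sigma> g p = induced_action (cmat (r (matrix_inv g))) (cmat (w g)) p"
  using assms by (intro kauto_eq_induced_action) (auto simp: classical_action_def)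

lemma lorentzian_basis:
  fixes G :: "real^'n::finite^'n"
  assumes "lorentzian G"
  obtains P :: "real^'n^'n" where "invertible P"
    "\<And>i j. i \<noteq> j \<Longrightarrow> bform G (P *v axis i 1) (P *v axis j 1) = 0"
    "\<And>i. bform G (P *v axis i 1) (P *v axis i 1) \<noteq> 0" "det G \<noteq> 0"
proof -
  obtain P :: "real^'n^'n" and t where P: "invertible P"
    "\<And>i j. (transpose P ** G ** P) $ i $ j = (if i \<noteq> j then 0 else if i = t then 1 else -1)"
    using assms by (auto simp: lorentzian_def)
  have eq: "bform G (P *v axis i 1) (P *v axis j 1) = (if i \<noteq> j then 0 else if i = t then 1 else -1)" for i j
    using P(2) bform_axis[of "transpose P ** G ** P" i j] by (simp only: bform_congruence)
  have "det (transpose P ** G ** P) = (\<Prod>i\<in>UNIV. (transpose P ** G ** P) $ i $ i)"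
    by (rule det_diagonal) (simp add: P(2))
  also have "\<dots> \<noteq> 0" by (simp add: P(2))
  finally have "det G \<noteq> 0" by (auto simp: det_mul)
  with P(1) eq show ?thesis by (intro that[of P]) auto
qed

text \<open>Pairs have determinant 1 and the reflection in a basis vector has determinant -1, so
  \<open>det A = 1\<close> excludes an odd product.\<close>

lemma L_plus_in_reflection_pair_products:
  fixes G :: "real^'n::finite^'n"
  assumes lor: "lorentzian G" and A: "A \<in> L_plus G"
  shows "A \<in> reflection_pair_products G"
proof -
  have sym: "transpose G = G" using lor by (simp add: lorentzian_def)
  obtain P :: "real^'n^'n" where P: "invertible P"
    "\<And>i j. i \<noteq> j \<Longrightarrow> bform G (P *v axis i 1) (P *v axis j 1) = 0"
    "\<And>i. bform G (P *v axis i 1) (P *v axis i 1) \<noteq> 0" and det: "det G \<noteq> 0"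
    using lorentzian_basis[OF lor] by metis
  \<comment> \<open>Any basis vector would do; \<open>undefined\<close> merely picks an
    index.\<close>
  define p where "p = P *v axis undefined 1"
  have p: "bform G p p \<noteq> 0" "det (reflection G p) = -1"
    using P(3) det_reflection_basis[OF sym P(1) P(2) P(3)] by (simp_all add: p_def)
  have pairs: "det B = 1" if "B \<in> reflection_pair_products G" for B
    using that
  proof induction
    case (mult u v A)
    then interpret reflection_curve G u v
      using sym det by unfold_locales auto
    \<comment> \<open>The pair is the point of its curve at parameter 1, and the curve has
      determinant 1 throughout.\<close>
    have "det (reflection G v ** reflection G u) = 1"
      using rcurve_in_L_plus[of 1] param_dom_0_1(2) by (simp add: rcurve_def L_plus_def)
    then show ?case using mult by (simp add: det_mul)
  qed simp
  have "A \<in> reflection_products G"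
    using A by (intro isometry_in_reflection_products[OF sym P]) (auto simp: L_plus_def lorentz_group_def)
  from reflection_products_cases[OF sym p(1) this] show ?thesis
    using pairs p(2) A by (auto simp: det_mul L_plus_def)
qed

theorem theorem1:
  fixes G :: "real^'n::finite^'n"
    and \<rho> :: "real^'n^'n \<Rightarrow> real^'v::finite^'v"
    and \<rho>C :: "complex^'n^'n \<Rightarrow> complex^'v^'v"
    and \<omega> :: "real^'n^'n \<Rightarrow> real^'n^'n"
    and \<omega>C :: "complex^'n^'n \<Rightarrow> complex^'n^'n"
    and \<sigma> \<sigma>' :: "real^'n^'n \<Rightarrow> ('v, 'n) kalg \<Rightarrow> ('v, 'n) kalg"
    and D :: "('v, 'n) kalg set"
  assumes "CARD('n) \<ge> 3"
    and "lorentzian G"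
    and "holo_extension G \<rho> \<rho>C"
    and "holo_extension G \<omega> \<omega>C"
    and "classical_action (L_up G) \<rho> \<omega> \<sigma>"
    and "classical_action (L_plus G) (real_restr \<rho>C) (real_restr \<omega>C) \<sigma>'"
    and "caffine D"
    and "invariant_under \<sigma> (L_up G) D"
  shows "invariant_under \<sigma>' (L_down G) D"
proof -
  have sym: "transpose G = G" using assms(2) by (simp add: lorentzian_def)
  have det: "det G \<noteq> 0" using lorentzian_basis[OF assms(2)] by metis
  have pair: "reflection G v ** reflection G u \<in> L_plus G"
      "x \<in> D \<Longrightarrow> \<sigma>' (reflection G v ** reflection G u) x \<in> D"
    if uv: "bform G u u \<noteq> 0" "bform G v v \<noteq> 0" for u v x
  proof -
    interpret reflection_curve G u v using sym det uv by unfold_locales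
    have g: "rcurve 1 = reflection G v ** reflection G u" by (simp add: rcurve_def)
    have one: "of_real 1 \<in> param_dom" using param_dom_0_1(2) by simp
    show "reflection G v ** reflection G u \<in> L_plus G"
      using rcurve_in_L_plus[OF one] g by simp
    obtain e where e: "e > 0" "\<And>t. t \<in> {0..e} \<Longrightarrow> of_real t \<in> param_dom"
      using interval_in_param_dom by blast
    assume x: "x \<in> D"
    \<comment> \<open>The complexified action along the curve; \<open>\<rho>C\<close> is taken at
      the inverse because functionals transform by composition with \<open>\<rho>\<close> of the
      inverse element.\<close>
    define F where "F z = induced_action (\<rho>C (curve_inv z)) (\<omega>C (curve z)) x" for z
    have holo: "holo_on (L_plus_C G) \<rho>C" "holo_on (L_plus_C G) \<omega>C"
      using assms(3,4) by (simp_all add: holo_extension_def)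
    have "F 1 \<in> D"
    proof (rule khol_identity[OF assms(7) _ open_param_dom connected_param_dom])
      show "khol param_dom F"
        unfolding F_def
        by (intro khol_induced_action holo_on_compose[OF holo(1) open_param_dom] holo_on_compose[OF holo(2) open_param_dom]
            holomorphic_curve curve_in_L_plus_C)
      show "complex_of_real ` {0..e} \<subseteq> param_dom" using e(2) by blast
      show "F z \<in> D" if "z \<in> complex_of_real ` {0..e}" for z
      proof -
        from that obtain t where t: "t \<in> {0..e}" "z = of_real t" by (rule imageE)
        note up = rcurve_in_L_up[OF e(2) t(1)]
        \<comment> \<open>For these parameters the curve lies in \<open>L_up G\<close>, where
          \<open>\<rho>C\<close> and \<open>\<omega>C\<close> restrict to \<open>\<rho>\<close> and
          \<open>\<omega>\<close>, so the assumed invariance applies.\<close>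
        have "F z = \<sigma> (rcurve t) x"
          using assms(3,4) up
          by (simp add: F_def t(2) curve_of_real classical_action_eq_induced_action[OF assms(5)]
              matrix_inv_rcurve[OF e(2)[OF t(1)]] holo_extension_def)
        then show ?thesis using assms(8) up(1) x by (auto simp: invariant_under_def)
      qed
    qed (use param_dom_0_1 islimpt_real_interval[OF e(1)] in auto)
    \<comment> \<open>By \<open>extension_real\<close> the extensions are real matrices at parameter
      1, so taking real parts in \<open>real_restr\<close> loses nothing.\<close>
    moreover have "F 1 = \<sigma>' (rcurve 1) x"
      using extension_real[OF assms(3) one] extension_real[OF assms(4) one]
      by (simp add: F_def classical_action_eq_induced_action[OF assms(6) rcurve_in_L_plus[OF one]]
          matrix_inv_rcurve[OF one])
    ultimately show "\<sigma>' (reflection G v ** reflection G u) x \<in> D" by (simp add: g)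
  qed
  \<comment> \<open>Membership in \<open>L_plus G\<close> is carried through the induction because
    multiplicativity of \<open>\<sigma>'\<close> is given only there.\<close>
  have "A \<in> L_plus G \<and> (\<forall>x\<in>D. \<sigma>' A x \<in> D)" if "A \<in> reflection_pair_products G" for A
    using that
  proof induction
    case one
    then show ?case
      using assms(6) by (simp add: classical_action_def L_plus_def lorentz_group_def)
  next
    case (mult u v A)
    note g = pair[OF mult(1,2)]
    have "\<sigma>' (reflection G v ** reflection G u ** A) = \<sigma>' (reflection G v ** reflection G u) \<circ> \<sigma>' A"
      using assms(6) g(1) mult.IH by (auto simp: classical_action_def)
    moreover have "reflection G v ** reflection G u ** A \<in> L_plus G"
      using g(1) mult.IH by (auto simp: L_plus_def lorentz_group_def det_mul intro!: isometry_mult)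
    ultimately show ?case using g(2) mult.IH by auto
  qed
  then show ?thesis
    using L_plus_in_reflection_pair_products[OF assms(2)]
    by (auto simp: invariant_under_def L_down_def)
qed

end
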